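(* Let $I$ be a finite set of items, let $s(i)$ be a positive integer size for each $i\in I$, and let $f\colon 2^I\to\mathbb{R}_+$ be monotone and submodular with $f(\emptyset)=0$. Let $\gamma\in(0,1]$. The deterministic adaptive policy $\mathcal{P}$ (with cancellation, unknown capacity) described in the context, which uses a $\gamma$-approximation algorithm to build the set $S$, is $\min\{2\gamma/21,\ (1-1/\sqrt[3]{e})/3\}$-robust; that is, for every capacity $C\in\mathbb{R}_+$, $$f(\mathcal{P}(C))\ \ge\ \min\left\{\frac{2\gamma}{21},\ \frac{1-1/\sqrt[3]{e}}{3}\right\}\cdot f(\mathrm{OPT}_C).$$ In particular, it is $2(1-1/e)/21$-robust (where $2(1-1/e)/21>0.060$) when $\gamma=1-1/e$, and $(1-1/\sqrt[3]{e})/3$-robust (where $(1-1/\sqrt[3]{e})/3>0.094$) when $\gamma=1$.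
   Context: Problem (submodular maximization with unknown knapsack capacity, with cancellation): the capacity $C$ is unknown. Items are tried one at a time, each at most once. When item $i$ is tried and the current knapsack content is $X$, we learn whether $i$ fits, i.e. whether $s(X)+s(i)\le C$, where $s(X)=\sum_{j\in X}s(j)$. If it fits, $i$ is irrevocably added to $X$; otherwise $i$ is discarded and the process continues with the remaining items. An adaptive policy $\mathcal{P}$ is a binary decision tree specifying the next item to try depending on the observations so far. $\mathcal{P}(C)$ denotes the final content of the knapsack when the capacity is $C$. For $c\ge 0$, $\mathrm{OPT}_c$ denotes a set maximizing $f(X)$ over $X\subseteq I$ with $s(X)\le c$. A deterministic policy is $\alpha$-robust if $f(\mathcal{P}(C))\ge\alpha f(\mathrm{OPT}_C)$ for every $C\in\mathbb{R}_+$. Policy $\mathcal{P}^1$ for $(I',U)$, where $U\subseteq I'\subseteq I$: start with $X=U$, $R=I'\setminus U$. For $j=1,\dots,|I'\setminus U|$: choose $i_j\in\arg\max\{(f(X\cup\{i\})-f(X))/s(i)\colon i\in R\}$ (ties arbitrary); if $s(X)+s(i_j)\le C$ set $X\leftarrow X\cup\{i_j\}$, otherwise discard $i_j$; set $R\leftarrow R\setminus\{i_j\}$. Output $X$. The policy $\mathcal{P}$: (1) Construct $S\subseteq I$ as follows. For each $i\in I$, let $L_i$ be a $\gamma$-approximate solution to $\max\{f(X)\colon X\subseteq I,\ s(X)\le s(i)/2\}$, i.e. $s(L_i)\le s(i)/2$ and $f(L_i)\ge\gamma f(\mathrm{OPT}_{s(i)/2})$; put $i\in S$ if and only if $f(\{i\})\ge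 2f(L_i)$. (2) Start with $U=\emptyset$, $R=I$. While $U=\emptyset$ and $S\cap R\neq\emptyset$: choose $i\in\arg\max\{f(\{i\})\colon i\in S\cap R\}$ and try it; if it fits ($s(i)\le C$) set $U\leftarrow\{i\}$, otherwise discard it; set $R\leftarrow R\setminus\{i\}$. (3) Execute $\mathcal{P}^1$ for $(R\cup U,U)$ and output its result. *)

theory Defs
  imports Complex_Main
begin

definition submodular_on :: "'a set \<Rightarrow> ('a set \<Rightarrow> real) \<Rightarrow> bool" where
  "submodular_on I f \<longleftrightarrow>
     (\<forall>X Y. X \<subseteq> I \<longrightarrow> Y \<subseteq> I \<longrightarrow> f (X \<union> Y) + f (X \<inter> Y) \<le> f X + f Y)"

definition OPT :: "'a set \<Rightarrow> ('a \<Rightarrow> nat) \<Rightarrow> ('a set \<Rightarrow> real) \<Rightarrow> real \<Rightarrow> 'a set" where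
  "OPT I s f c = (ARG_MAX f X. X \<subseteq> I \<and> real (sum s X) \<le> c)"

definition approx_solution ::
  "'a set \<Rightarrow> ('a \<Rightarrow> nat) \<Rightarrow> ('a set \<Rightarrow> real) \<Rightarrow> real \<Rightarrow> real \<Rightarrow> 'a set \<Rightarrow> bool" where
  "approx_solution I s f \<gamma> c X \<longleftrightarrow>
     X \<subseteq> I \<and> real (sum s X) \<le> c \<and> f X \<ge> \<gamma> * f (OPT I s f c)"

text \<open>
  A policy is a binary decision tree: \<open>Try i p q\<close> tries item \<open>i\<close> and continues with \<open>p\<close> if it
  fits and with \<open>q\<close> if it is discarded. The tree does not mention the capacity, so the next item
  depends on the observations only.
\<close>

datatype 'a policy = Stop | Try 'a "'a policy" "'a policy"

text \<open>Only available items are tried, and on every branch each of them at most once.\<close>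

primrec adaptive_policy :: "'a set \<Rightarrow> 'a policy \<Rightarrow> bool" where
  "adaptive_policy R Stop \<longleftrightarrow> True"
| "adaptive_policy R (Try i p q) \<longleftrightarrow>
     i \<in> R \<and> adaptive_policy (R - {i}) p \<and> adaptive_policy (R - {i}) q"

primrec run :: "('a \<Rightarrow> nat) \<Rightarrow> real \<Rightarrow> 'a policy \<Rightarrow> 'a set \<Rightarrow> 'a set" where
  "run s C Stop X = X"
| "run s C (Try i p q) X =
     (if real (sum s X) + real (s i) \<le> C then run s C p (X \<union> {i}) else run s C q X)"

definition outcome :: "('a \<Rightarrow> nat) \<Rightarrow> 'a policy \<Rightarrow> real \<Rightarrow> 'a set" where
  "outcome s p C = run s C p {}"

definition robust ::
  "'a set \<Rightarrow> ('a \<Rightarrow> nat) \<Rightarrow> ('a set \<Rightarrow> real) \<Rightarrow> real \<Rightarrow> 'a policy \<Rightarrow> bool" where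
  "robust I s f \<alpha> p \<longleftrightarrow>
     adaptive_policy I p \<and> (\<forall>C\<ge>0. f (outcome s p C) \<ge> \<alpha> * f (OPT I s f C))"

text \<open>
  The algorithms below break ties arbitrarily, so they are predicates that hold of every decision
  tree arising from some way of breaking the ties (possibly depending on the history).
  In \<open>greedy s f X R p\<close>, the set \<open>X\<close> is the current content and \<open>R\<close> the set of untried items.
\<close>

inductive greedy ::
  "('a \<Rightarrow> nat) \<Rightarrow> ('a set \<Rightarrow> real) \<Rightarrow> 'a set \<Rightarrow> 'a set \<Rightarrow> 'a policy \<Rightarrow> bool"
  for s f where
  greedy_stop: "greedy s f X {} Stop"
| greedy_try:
    "is_arg_max (\<lambda>j. (f (X \<union> {j}) - f X) / real (s j)) (\<lambda>j. j \<in> R) i \<Longrightarrow>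
     greedy s f (X \<union> {i}) (R - {i}) p \<Longrightarrow>
     greedy s f X (R - {i}) q \<Longrightarrow>
     greedy s f X R (Try i p q)"

definition policy_P1 ::
  "('a \<Rightarrow> nat) \<Rightarrow> ('a set \<Rightarrow> real) \<Rightarrow> 'a set \<Rightarrow> 'a set \<Rightarrow> 'a policy \<Rightarrow> bool" where
  "policy_P1 s f I' U p \<longleftrightarrow> greedy s f U (I' - U) p"

definition single_items ::
  "'a set \<Rightarrow> ('a set \<Rightarrow> real) \<Rightarrow> ('a \<Rightarrow> 'a set) \<Rightarrow> 'a set" where
  "single_items I f L = {i \<in> I. f {i} \<ge> 2 * f (L i)}"

text \<open>
  The loop trying single items while \<open>U = {}\<close>, followed by \<open>policy_P1\<close> for \<open>(R \<union> U, U)\<close>; the loop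
  is left either with \<open>U = {}\<close> and no single item remaining, or with \<open>U = {i}\<close> after the first
  item \<open>i\<close> that fits.
\<close>

inductive single_phase ::
  "('a \<Rightarrow> nat) \<Rightarrow> ('a set \<Rightarrow> real) \<Rightarrow> 'a set \<Rightarrow> 'a set \<Rightarrow> 'a policy \<Rightarrow> bool"
  for s f S where
  single_none:
    "S \<inter> R = {} \<Longrightarrow>
     policy_P1 s f (R \<union> {}) {} p \<Longrightarrow>
     single_phase s f S R p"
| single_try:
    "is_arg_max (\<lambda>j. f {j}) (\<lambda>j. j \<in> S \<inter> R) i \<Longrightarrow>
     policy_P1 s f ((R - {i}) \<union> {i}) {i} p \<Longrightarrow>
     single_phase s f S (R - {i}) q \<Longrightarrow>
     single_phase s f S R (Try i p q)"

definition policy_P ::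
  "'a set \<Rightarrow> ('a \<Rightarrow> nat) \<Rightarrow> ('a set \<Rightarrow> real) \<Rightarrow> ('a \<Rightarrow> 'a set) \<Rightarrow> 'a policy \<Rightarrow> bool" where
  "policy_P I s f L p \<longleftrightarrow> single_phase s f (single_items I f L) I p"

text \<open>Decision trees and approximate solutions as above always exist.\<close>

lemma ex_is_arg_max:
  fixes g :: "'a \<Rightarrow> real"
  assumes "finite R" "R \<noteq> {}"
  shows "\<exists>i. is_arg_max g (\<lambda>j. j \<in> R) i"
proof -
  have "Max (g ` R) \<in> g ` R" using assms by simp
  then obtain i where "i \<in> R" "g i = Max (g ` R)" by auto
  then have "is_arg_max g (\<lambda>j. j \<in> R) i"
    using assms by (simp add: is_arg_max_linorder)
  then show ?thesis ..
qed

lemma ex_greedy: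
  assumes "finite R"
  shows "\<exists>p. greedy s f X R p"
  using assms
proof (induction R arbitrary: X rule: finite_psubset_induct)
  case (psubset R)
  show ?case
  proof (cases "R = {}")
    case True
    then show ?thesis using greedy_stop by blast
  next
    case False
    then obtain i where i: "is_arg_max (\<lambda>j. (f (X \<union> {j}) - f X) / real (s j)) (\<lambda>j. j \<in> R) i"
      using ex_is_arg_max[OF psubset.hyps False] by blast
    then have "i \<in> R" by (simp add: is_arg_max_def)
    then have "R - {i} \<subset> R" by blast
    then obtain p q where "greedy s f (X \<union> {i}) (R - {i}) p" "greedy s f X (R - {i}) q"
      using psubset.IH by meson
    then show ?thesis using greedy_try[OF i] by blast
  qed
qed

lemma ex_single_phase:
  assumes "finite R"
  shows "\<exists>p. single_phase s f S R p"
  using assms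
proof (induction R rule: finite_psubset_induct)
  case (psubset R)
  have P1: "\<exists>p. policy_P1 s f (R' \<union> U) U p" if "R' \<subseteq> R" for R' U
  proof -
    have "finite (R' \<union> U - U)" using that psubset.hyps by (simp add: Un_Diff finite_subset)
    then show ?thesis unfolding policy_P1_def by (rule ex_greedy)
  qed
  show ?case
  proof (cases "S \<inter> R = {}")
    case True
    then show ?thesis using P1[of R "{}"] single_none[OF True] by blast
  next
    case False
    then obtain i where i: "is_arg_max (\<lambda>j. f {j}) (\<lambda>j. j \<in> S \<inter> R) i"
      using ex_is_arg_max[OF finite_Int[OF disjI2[OF psubset.hyps]] False] by blast
    then have "i \<in> R" by (simp add: is_arg_max_def)
    then have "R - {i} \<subset> R" by blast
    then obtain q where q: "single_phase s f S (R - {i}) q" using psubset.IH by blast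
    obtain p where p: "policy_P1 s f ((R - {i}) \<union> {i}) {i} p" using P1[of "R - {i}" "{i}"] by blast
    show ?thesis using single_try[OF i p q] by blast
  qed
qed

lemma ex_policy_P: "finite I \<Longrightarrow> \<exists>p. policy_P I s f L p"
  unfolding policy_P_def by (rule ex_single_phase)

lemma ex_approx_solution:
  assumes "finite I" "\<And>X. X \<subseteq> I \<Longrightarrow> f X \<ge> 0" "\<gamma> \<le> 1" "c \<ge> 0"
  shows "\<exists>X. approx_solution I s f \<gamma> c X"
proof -
  let ?F = "{X. X \<subseteq> I \<and> real (sum s X) \<le> c}"
  have fin: "finite ?F" using assms(1) by simp
  have "{} \<in> ?F" using assms(4) by simp
  then have "?F \<noteq> {}" by blast
  from ex_is_arg_max[OF fin this, of f]
  have "\<exists>X. is_arg_max f (\<lambda>X. X \<subseteq> I \<and> real (sum s X) \<le> c) X" by simp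
  from someI_ex[OF this]
  have "is_arg_max f (\<lambda>X. X \<subseteq> I \<and> real (sum s X) \<le> c) (OPT I s f c)"
    unfolding OPT_def arg_max_def .
  then have o: "OPT I s f c \<subseteq> I" "real (sum s (OPT I s f c)) \<le> c"
    by (simp_all only: is_arg_max_def)
  have "\<gamma> * f (OPT I s f c) \<le> f (OPT I s f c)"
    using mult_right_mono[OF assms(3) assms(2)[OF o(1)]] by simp
  then show ?thesis using o unfolding approx_solution_def by blast
qed

end

theory Submission
  imports Defs
begin

text \<open>
  Let \<open>U\<close> be the content after the single-item phase and \<open>O\<close> an optimal set for capacity \<open>C\<close>.
  A single item \<open>j\<close> that fits has either value at most \<open>f U\<close>, or at most twice the value of
  some set of half its size.
  If \<open>U = {u}\<close> with \<open>s u > C / 3\<close>, then \<open>f U\<close> is at least \<open>2 * \<gamma>\<close> times the value of any set of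
  size at most \<open>s u / 2\<close>, and splitting \<open>O\<close> into few such sets and single items gives
  \<open>f O \<le> 20 * (f U / (2 * \<gamma>))\<close>.
  Otherwise the greedy phase has room of at least \<open>C / 3\<close> beyond any one small item, so it
  recovers a \<open>1 - exp (- 1 / 3)\<close> fraction of the items of \<open>O\<close> of size at most \<open>C / 3\<close>.
  Of the at most two larger items, a lone one is worth at most twice a set of size \<open>C / 2\<close>
  (fraction \<open>1 - exp (- 1 / 3)\<close> again), and each of two at most twice a set of size \<open>C / 3\<close>
  (fraction \<open>1 - exp (- 1)\<close>).
\<close>

section \<open>Runs of decision trees and the outcome of the single-item phase\<close>

lemma run_superset: "X \<subseteq> run s C p X"
  by (induction p arbitrary: X) (auto, blast)

lemma run_subset: "adaptive_policy R p \<Longrightarrow> run s C p X \<subseteq> X \<union> R"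
proof (induction p arbitrary: X R)
  case (Try i p q)
  then have "run s C p (X \<union> {i}) \<subseteq> X \<union> {i} \<union> (R - {i})" "run s C q X \<subseteq> X \<union> (R - {i})" "i \<in> R"
    by auto
  then show ?case by auto
qed simp

lemma adaptive_greedy: "greedy s f X R p \<Longrightarrow> adaptive_policy R p"
  by (induction rule: greedy.induct) (auto simp: is_arg_max_def)

lemma adaptive_single_phase: "single_phase s f S R p \<Longrightarrow> adaptive_policy R p"
proof (induction rule: single_phase.induct)
  case (single_none R p)
  then show ?case by (simp add: policy_P1_def adaptive_greedy)
next
  case (single_try R i p q)
  then have "adaptive_policy (insert i (R - {i}) - {i}) p"
    by (simp add: policy_P1_def adaptive_greedy)
  with single_try show ?case by (auto simp: is_arg_max_def)
qed

lemma is_arg_max_OPT: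
  assumes "finite I" "c \<ge> 0"
  shows "is_arg_max f (\<lambda>X. X \<subseteq> I \<and> real (sum s X) \<le> c) (OPT I s f c)"
proof -
  let ?F = "{X. X \<subseteq> I \<and> real (sum s X) \<le> c}"
  have "finite ?F" using assms(1) by simp
  moreover have "?F \<noteq> {}" using assms(2) by (auto intro!: exI[of _ "{}"])
  ultimately have "\<exists>X. is_arg_max f (\<lambda>X. X \<in> ?F) X" by (rule ex_is_arg_max)
  then have "\<exists>X. is_arg_max f (\<lambda>X. X \<subseteq> I \<and> real (sum s X) \<le> c) X" by simp
  from someI_ex[OF this] show ?thesis unfolding OPT_def arg_max_def .
qed

text \<open>The hypothesis that every item outside \<open>R\<close> is too large is the loop
  invariant: single items are dropped only when they overflow. So the first one that fits is a
  maximum over all fitting members of \<open>S\<close>. If none fits, \<open>U\<close> is empty and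
  the bound over \<open>S\<close> is vacuous.\<close>

lemma single_phase_cases:
  assumes "single_phase s f S R p" "R \<subseteq> I" "S \<subseteq> I" "\<forall>j\<in>I - R. C < real (s j)"
    and "f {} = 0"
  obtains q U R' where "run s C p {} = run s C q U" "greedy s f U R' q" "R' \<subseteq> I" "U \<inter> R' = {}"
    "\<forall>j\<in>I. real (s j) \<le> C \<longrightarrow> j \<in> U \<union> R'"
    "\<forall>j\<in>S. real (s j) \<le> C \<longrightarrow> f {j} \<le> f U"
    "U = {} \<or> (\<exists>u\<in>S. U = {u} \<and> real (s u) \<le> C)"
  using assms
proof (induction arbitrary: thesis rule: single_phase.induct)
  case (single_none R p)
  then have "greedy s f {} R p" by (simp add: policy_P1_def)
  moreover have "j \<in> R" if "j \<in> I" "real (s j) \<le> C" for j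
    using single_none.prems(4) that by force
  moreover from this have "\<not> real (s j) \<le> C" if "j \<in> S" for j
    using single_none.prems(3) single_none.hyps(1) that by blast
  ultimately show ?case using single_none.prems(1)[of p "{}" R] single_none.prems(2) by blast
next
  case (single_try R i p q)
  have i: "i \<in> S" "i \<in> R" and max: "\<And>j. j \<in> S \<Longrightarrow> j \<in> R \<Longrightarrow> f {j} \<le> f {i}"
    using single_try.hyps(1) by (auto simp: is_arg_max_linorder)
  have fits: "j \<in> R" if "j \<in> I" "real (s j) \<le> C" for j
    using single_try.prems(4) that by force
  show ?case
  proof (cases "real (s i) \<le> C")
    case True
    have "insert i (R - {i}) - {i} = R - {i}" by blast
    then have "greedy s f {i} (R - {i}) p"
      using single_try.hyps(2) by (simp add: policy_P1_def)
    moreover have "run s C (Try i p q) {} = run s C p {i}" using True by simp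
    moreover have "R - {i} \<subseteq> I" "{i} \<inter> (R - {i}) = {}" using single_try.prems(2) by auto
    ultimately show ?thesis
      using single_try.prems(1)[of p "{i}" "R - {i}"] single_try.prems(3) i max fits True by blast
  next
    case False
    show ?thesis
    proof (rule single_try.IH)
      show "R - {i} \<subseteq> I" "S \<subseteq> I" "f {} = 0" using single_try.prems by auto
      show "\<forall>j\<in>I - (R - {i}). C < real (s j)"
        using False single_try.prems(4) by auto
    qed (use single_try.prems(1) False in auto)
  qed
qed

section \<open>Monotone submodular values and additive sizes\<close>

locale knapsack =
  fixes I :: "'a set" and s :: "'a \<Rightarrow> nat" and f :: "'a set \<Rightarrow> real"
  assumes finite_I: "finite I"
    and size_pos: "i \<in> I \<Longrightarrow> s i > 0"
    and f_mono: "X \<subseteq> Y \<Longrightarrow> Y \<subseteq> I \<Longrightarrow> f X \<le> f Y"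
    and f_submodular: "X \<subseteq> I \<Longrightarrow> Y \<subseteq> I \<Longrightarrow> f (X \<union> Y) + f (X \<inter> Y) \<le> f X + f Y"
    and f_empty: "f {} = 0"
begin

lemma f_nonneg: "X \<subseteq> I \<Longrightarrow> 0 \<le> f X"
  using f_mono[of "{}" X] f_empty by simp

lemma f_Un_le: "X \<subseteq> I \<Longrightarrow> Y \<subseteq> I \<Longrightarrow> f (X \<union> Y) \<le> f X + f Y"
  using f_submodular[of X Y] f_nonneg[of "X \<inter> Y"] by (simp add: le_infI1)

lemma f_remove_le:
  assumes "x \<in> T" "T \<subseteq> I"
  shows "f T \<le> f {x} + f (T - {x})"
proof -
  have "{x} \<union> (T - {x}) = T" using assms by blast
  then show ?thesis using f_Un_le[of "{x}" "T - {x}"] assms by auto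
qed

lemma size_remove:
  assumes "x \<in> T" "T \<subseteq> I"
  shows "real (sum s T) = real (s x) + real (sum s (T - {x}))"
  using sum.remove[of T x s] assms finite_subset[OF assms(2) finite_I] by simp

lemma size_mono: "X \<subseteq> Y \<Longrightarrow> Y \<subseteq> I \<Longrightarrow> real (sum s X) \<le> real (sum s Y)"
  using sum_mono2[of Y X s] finite_subset[OF _ finite_I, of Y] by (intro of_nat_mono) auto

lemma size_item_le: "x \<in> T \<Longrightarrow> T \<subseteq> I \<Longrightarrow> real (s x) \<le> real (sum s T)"
  using size_mono[of "{x}" T] by simp

text \<open>Diminishing returns: for a new \<open>t\<close>, the sets \<open>X \<union> T\<close>
  and \<open>X \<union> {t}\<close> meet exactly in \<open>X\<close>, so \<open>t\<close> gains no
  more on top of \<open>X \<union> T\<close> than on top of \<open>X\<close>.\<close>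

lemma f_gain_sum:
  assumes "X \<subseteq> I" "T \<subseteq> I"
  shows "f (X \<union> T) - f X \<le> (\<Sum>t\<in>T - X. f (X \<union> {t}) - f X)"
proof -
  have "finite T" using assms finite_I finite_subset by blast
  then show ?thesis using assms(2)
  proof (induction T)
    case (insert t T)
    show ?case
    proof (cases "t \<in> X")
      case True
      then show ?thesis using insert by (simp add: insert_absorb)
    next
      case False
      have "(X \<union> T) \<union> (X \<union> {t}) = X \<union> insert t T" "(X \<union> T) \<inter> (X \<union> {t}) = X"
        using insert.hyps(2) False by auto
      then have "f (X \<union> insert t T) + f X \<le> f (X \<union> T) + f (X \<union> {t})"
        using f_submodular[of "X \<union> T" "X \<union> {t}"] assms(1) insert.prems by auto
      moreover have "insert t T - X = insert t (T - X)" using False by blast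
      ultimately show ?thesis using insert by simp
    qed
  qed simp
qed

section \<open>Value guarantee of greedy filling\<close>

text \<open>Every item of \<open>T\<close> outside \<open>X\<close> is still in \<open>R\<close>,
  hence at most as dense as \<open>i\<close>, and the gains of these items add up to at least
  \<open>f T - f X\<close>.\<close>

lemma density_bound:
  assumes "X \<subseteq> I" "T \<subseteq> X \<union> R" "R \<subseteq> I"
    and "is_arg_max (\<lambda>j. (f (X \<union> {j}) - f X) / real (s j)) (\<lambda>j. j \<in> R) i"
    and "real (sum s T) \<le> \<tau>"
  shows "real (s i) * (f T - f X) \<le> \<tau> * (f (X \<union> {i}) - f X)"
proof -
  define \<rho> where "\<rho> = (f (X \<union> {i}) - f X) / real (s i)"
  have i: "i \<in> R" "i \<in> I" and max: "\<And>j. j \<in> R \<Longrightarrow> (f (X \<union> {j}) - f X) / real (s j) \<le> \<rho>"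
    using assms(3,4) unfolding \<rho>_def by (auto simp: is_arg_max_linorder)
  have T: "T \<subseteq> I" using assms by blast
  have "f X \<le> f (X \<union> {i})" using f_mono[of X "X \<union> {i}"] assms(1) i by auto
  then have \<rho>: "\<rho> \<ge> 0" "f (X \<union> {i}) - f X = \<rho> * real (s i)"
    using size_pos[OF i(2)] by (simp_all add: \<rho>_def)
  have "f T - f X \<le> f (X \<union> T) - f X" using f_mono[of T "X \<union> T"] T assms(1) by auto
  also have "\<dots> \<le> (\<Sum>t\<in>T - X. f (X \<union> {t}) - f X)" using assms(1) T by (rule f_gain_sum)
  also have "\<dots> \<le> (\<Sum>t\<in>T - X. \<rho> * real (s t))"
  proof (rule sum_mono)
    fix t assume "t \<in> T - X"
    then have "t \<in> R" "s t > 0" using assms(2,3) size_pos by auto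
    then show "f (X \<union> {t}) - f X \<le> \<rho> * real (s t)"
      using max[of t] by (simp add: divide_le_eq)
  qed
  also have "\<dots> = \<rho> * real (sum s (T - X))" by (simp add: sum_distrib_left)
  also have "\<dots> \<le> \<rho> * \<tau>"
    using size_mono[of "T - X" T] T assms(5) \<rho>(1) by (intro mult_left_mono) auto
  finally have "real (s i) * (f T - f X) \<le> real (s i) * (\<rho> * \<tau>)" by (intro mult_left_mono) auto
  then show ?thesis unfolding \<rho>(2) by (simp add: algebra_simps)
qed

lemma f_le_run:
  assumes "greedy s f X R p" "X \<subseteq> I" "R \<subseteq> I"
  shows "f X \<le> f (run s C p X)"
  using run_subset[OF adaptive_greedy[OF assms(1)], of s C X] assms(2,3)
  by (intro f_mono run_superset) auto

text \<open>
  If an item of \<open>T\<close> is discarded, the content already exceeds \<open>C - b\<close>, so the right-hand side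
  is at most the value at that moment; until then the gap to \<open>f T\<close> shrinks exponentially.
\<close>

lemma greedy_gap:
  assumes "greedy s f X R p" "X \<subseteq> I" "R \<subseteq> I" "X \<inter> R = {}" "T \<subseteq> X \<union> R"
    and "\<And>t. t \<in> T \<Longrightarrow> real (s t) \<le> b" "real (sum s T) \<le> \<tau>" "\<tau> > 0"
  shows "f T - max 0 (f T - f X) * exp (- (C - b - real (sum s X)) / \<tau>) \<le> f (run s C p X)"
  using assms(1-5)
proof (induction rule: greedy.induct)
  case (greedy_stop X)
  then have "f T \<le> f X" using f_mono[of T X] by auto
  then show ?case by simp
next
  case (greedy_try X R i p q)
  let ?E = "exp (- (C - b - real (sum s X)) / \<tau>)"
  have i: "i \<in> R" "i \<in> I" "i \<notin> X"
    using greedy_try.hyps(1) greedy_try.prems by (auto simp: is_arg_max_def)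
  have le: "f X \<le> f (run s C (Try i p q) X)"
    using greedy.greedy_try[OF greedy_try.hyps] greedy_try.prems(1,2) by (rule f_le_run)
  have fin: "finite X" using greedy_try.prems finite_I finite_subset by blast
  consider "f T \<le> f X" | "f X < f T" "real (sum s X) + real (s i) \<le> C"
    | "f X < f T" "\<not> real (sum s X) + real (s i) \<le> C" "i \<in> T"
    | "f X < f T" "\<not> real (sum s X) + real (s i) \<le> C" "i \<notin> T"
    by linarith
  then show ?case
  proof cases
    case 1
    then show ?thesis using le by simp
  next
    case 2
    have "real (s i) * (f T - f X) \<le> \<tau> * (f (X \<union> {i}) - f X)"
      using greedy_try.prems(1,4,2) greedy_try.hyps(1) assms(7) by (rule density_bound)
    then have "real (s i) / \<tau> * (f T - f X) \<le> f (X \<union> {i}) - f X"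
      using assms(8) by (simp add: field_simps)
    then have "f T - f (X \<union> {i}) \<le> (1 - real (s i) / \<tau>) * (f T - f X)"
      by (simp add: algebra_simps)
    also have "\<dots> \<le> exp (- real (s i) / \<tau>) * (f T - f X)"
      using 2 exp_ge_add_one_self[of "- real (s i) / \<tau>"] by (intro mult_right_mono) auto
    finally have "max 0 (f T - f (X \<union> {i})) \<le> exp (- real (s i) / \<tau>) * (f T - f X)"
      using 2 by simp
    \<comment> \<open>Packing \<open>i\<close> raises the exponential by the factor
      \<open>exp (s i / \<tau>)\<close>, which cancels the factor by which the gap has just
      shrunk.\<close>
    moreover have "exp (- (C - b - real (sum s (X \<union> {i}))) / \<tau>) = ?E * exp (real (s i) / \<tau>)"
      using i fin by (simp add: exp_add[symmetric] add_divide_distrib[symmetric] algebra_simps)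
    ultimately have "max 0 (f T - f (X \<union> {i})) * exp (- (C - b - real (sum s (X \<union> {i}))) / \<tau>)
        \<le> exp (- real (s i) / \<tau>) * (f T - f X) * (?E * exp (real (s i) / \<tau>))"
      by (simp add: mult_right_mono)
    also have "\<dots> = (f T - f X) * ?E" by (simp add: exp_minus field_simps)
    finally have "max 0 (f T - f (X \<union> {i})) * exp (- (C - b - real (sum s (X \<union> {i}))) / \<tau>)
        \<le> (f T - f X) * ?E" .
    moreover have "f T - max 0 (f T - f (X \<union> {i})) * exp (- (C - b - real (sum s (X \<union> {i}))) / \<tau>)
        \<le> f (run s C p (X \<union> {i}))"
      using greedy_try.prems i by (intro greedy_try.IH(1)) auto
    ultimately show ?thesis using 2 by simp
  next
    case 3
    then have "- (C - b - real (sum s X)) / \<tau> \<ge> 0" using assms(6)[of i] assms(8) by simp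
    then have "?E \<ge> 1" by simp
    then have "f T - (f T - f X) * ?E \<le> f T - (f T - f X) * 1"
      using 3 by (intro diff_left_mono mult_left_mono) auto
    also have "\<dots> \<le> f (run s C (Try i p q) X)" using le by simp
    finally show ?thesis using 3 by simp
  next
    case 4
    \<comment> \<open>Discarding an item outside \<open>T\<close> keeps \<open>T\<close> within
      \<open>X \<union> (R - {i})\<close>.\<close>
    have "f T - max 0 (f T - f X) * ?E \<le> f (run s C q X)"
      using greedy_try.prems i 4 by (intro greedy_try.IH(2)) auto
    then show ?thesis using 4 by simp
  qed
qed

text \<open>\<open>\<theta>\<close> measures, in units of \<open>\<tau>\<close>, the room that
  remains after reserving \<open>b\<close> for a discarded item. The initial gap is at most
  \<open>f T\<close> because values are nonnegative.\<close>

lemma greedy_bound: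
  assumes "greedy s f X R p" "X \<subseteq> I" "R \<subseteq> I" "X \<inter> R = {}" "T \<subseteq> X \<union> R"
    and "\<And>t. t \<in> T \<Longrightarrow> real (s t) \<le> b" "real (sum s T) \<le> \<tau>" "\<tau> > 0"
    and "\<theta> \<ge> 0" "\<theta> * \<tau> \<le> C - b - real (sum s X)"
  shows "(1 - exp (- \<theta>)) * f T \<le> f (run s C p X)"
proof -
  have "- (C - b - real (sum s X)) / \<tau> \<le> - \<theta>"
    using assms(8,10) by (simp add: field_simps)
  moreover have "max 0 (f T - f X) \<le> f T" using f_nonneg[of X] f_nonneg[of T] assms(2,3,5) by auto
  ultimately have "max 0 (f T - f X) * exp (- (C - b - real (sum s X)) / \<tau>) \<le> f T * exp (- \<theta>)"
    by (intro mult_mono) auto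
  with greedy_gap[OF assms(1-8), of C] show ?thesis by (simp add: algebra_simps)
qed

section \<open>Splitting sets by size\<close>

text \<open>Take \<open>A\<close> inclusion-maximal among the subsets of \<open>T\<close> of size at
  most \<open>c\<close>. Any further \<open>x\<close> overflows \<open>c\<close>, so what remains
  besides \<open>A\<close> and \<open>x\<close> has size below \<open>d\<close>.\<close>

lemma split_bound:
  assumes "T \<subseteq> I" "real (sum s T) \<le> c + d" "c \<ge> 0" "d \<ge> 0"
    and "\<And>A. A \<subseteq> T \<Longrightarrow> real (sum s A) \<le> c \<Longrightarrow> f A \<le> \<alpha>"
    and "\<And>B. B \<subseteq> T \<Longrightarrow> real (sum s B) \<le> d \<Longrightarrow> f B \<le> \<beta>"
    and "\<And>x. x \<in> T \<Longrightarrow> f {x} \<le> \<xi>"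
    and "\<xi> \<ge> 0"
  shows "f T \<le> \<alpha> + \<xi> + \<beta>"
proof -
  let ?F = "{A. A \<subseteq> T \<and> real (sum s A) \<le> c}"
  have "finite T" using assms(1) finite_I finite_subset by blast
  then have "finite ?F" by simp
  moreover have "{} \<in> ?F" using assms(3) by simp
  then have "?F \<noteq> {}" by (metis empty_iff)
  ultimately have "\<exists>A\<in>?F. \<forall>B\<in>?F. A \<subseteq> B \<longrightarrow> A = B" by (rule finite_has_maximal)
  then obtain A where A: "A \<in> ?F" and max: "\<And>B. B \<in> ?F \<Longrightarrow> A \<subseteq> B \<Longrightarrow> A = B"
    by (elim bexE) simp
  have \<alpha>: "f A \<le> \<alpha>" using A assms(5) by blast
  have \<beta>: "0 \<le> \<beta>" using assms(4) assms(6)[of "{}"] f_empty by simp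
  show ?thesis
  proof (cases "A = T")
    case True
    then show ?thesis using \<alpha> \<beta> assms(8) by simp
  next
    case False
    then obtain x where x: "x \<in> T" "x \<notin> A" using A by blast
    then have "\<not> real (sum s (insert x A)) \<le> c" using max[of "insert x A"] A by blast
    moreover have "real (sum s T) = real (sum s (insert x A)) + real (sum s (T - insert x A))"
      using sum.subset_diff[of "insert x A" T s] x A \<open>finite T\<close> by simp
    ultimately have "f (T - insert x A) \<le> \<beta>" using assms(2) by (intro assms(6)) auto
    moreover have "T = A \<union> ({x} \<union> (T - insert x A))" using x A by blast
    then have "f T \<le> f A + f ({x} \<union> (T - insert x A))"
      using f_Un_le[of A "{x} \<union> (T - insert x A)"] assms(1) A x by auto
    moreover have "f ({x} \<union> (T - insert x A)) \<le> f {x} + f (T - insert x A)"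
      using assms(1) x by (intro f_Un_le) auto
    ultimately show ?thesis using \<alpha> assms(7)[OF x(1)] by linarith
  qed
qed

text \<open>
  Sets of size at most \<open>a\<close>, \<open>2 * a\<close>, \<open>3 * a\<close>, \<open>6 * a\<close> have value at most \<open>w\<close>, \<open>3 * w\<close>,
  \<open>7 * w\<close>, \<open>20 * w\<close>: in each step, either remove one large item or split as in \<open>split_bound\<close>.
\<close>

lemma six_fold_size_bound:
  assumes "J \<subseteq> I" "a > 0" "w \<ge> 0"
    and base: "\<And>T. T \<subseteq> J \<Longrightarrow> real (sum s T) \<le> a \<Longrightarrow> f T \<le> w"
    and single: "\<And>j. j \<in> J \<Longrightarrow> \<not> f {j} \<le> 2 * w \<Longrightarrow>
      \<exists>M \<subseteq> J. real (sum s M) \<le> real (s j) / 2 \<and> f {j} \<le> 2 * f M"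
    and T: "T \<subseteq> J" "real (sum s T) \<le> 6 * a"
  shows "f T \<le> 20 * w"
proof -
  \<comment> \<open>A bound \<open>v\<close> for size \<open>c\<close> carries over to items of size
    \<open>2 * c\<close> at the price of a factor 2.\<close>
  have item: "f {j} \<le> 2 * v"
    if "j \<in> J" "w \<le> v" "real (s j) \<le> 2 * c"
      and "\<And>M. M \<subseteq> J \<Longrightarrow> real (sum s M) \<le> c \<Longrightarrow> f M \<le> v" for j v c
  proof (cases "f {j} \<le> 2 * w")
    case False
    then obtain M where "M \<subseteq> J" "real (sum s M) \<le> real (s j) / 2" "f {j} \<le> 2 * f M"
      using single[of j] \<open>j \<in> J\<close> by blast
    with that(3) that(4)[of M] show ?thesis by linarith
  qed (use \<open>w \<le> v\<close> in simp)
  have size: "real (s x) \<le> c" if "x \<in> A" "A \<subseteq> J" "real (sum s A) \<le> c" for x A c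
    using size_item_le[of x A] subset_trans[of A J I] that \<open>J \<subseteq> I\<close> by linarith
  have remove: "f A \<le> f {x} + f (A - {x})"
      "real (sum s A) = real (s x) + real (sum s (A - {x}))" if "x \<in> A" "A \<subseteq> J" for x A
    using f_remove_le[of x A] size_remove[of x A] that \<open>J \<subseteq> I\<close> by blast+
  have two: "f A \<le> 3 * w" if A: "A \<subseteq> J" "real (sum s A) \<le> 2 * a" for A
  proof (cases "\<exists>x\<in>A. real (s x) > a")
    case True
    then obtain x where x: "x \<in> A" "real (s x) > a" by blast
    have "f {x} \<le> 2 * w"
      using x A size[of x A "2 * a"] \<open>a > 0\<close> base by (intro item[of x w a]) auto
    moreover have "f (A - {x}) \<le> w" using remove(2)[OF x(1) A(1)] x A by (intro base) auto
    ultimately show ?thesis using remove(1)[OF x(1) A(1)] by linarith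
  next
    case False
    have "f A \<le> w + w + w"
      using False A \<open>J \<subseteq> I\<close> \<open>a > 0\<close> \<open>w \<ge> 0\<close> by (intro split_bound[of A a a] base) (auto simp: not_less)
    then show ?thesis by simp
  qed
  have three: "f A \<le> 7 * w" if A: "A \<subseteq> J" "real (sum s A) \<le> 3 * a" for A
  proof (cases "\<exists>x\<in>A. real (s x) > 2 * a")
    case True
    then obtain x where x: "x \<in> A" "real (s x) > 2 * a" by blast
    \<comment> \<open>The constant 7 comes from this case: \<open>6 * w\<close> for the item and
      \<open>w\<close> for the rest. Splitting gives only \<open>6 * w\<close>.\<close>
    have "f {x} \<le> 2 * (3 * w)"
      using x A size[of x A "3 * a"] \<open>a > 0\<close> \<open>w \<ge> 0\<close> two by (intro item[of x "3 * w" "2 * a"]) auto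
    moreover have "f (A - {x}) \<le> w" using remove(2)[OF x(1) A(1)] x A by (intro base) auto
    ultimately show ?thesis using remove(1)[OF x(1) A(1)] by linarith
  next
    case False
    have "f {x} \<le> 2 * w" if "x \<in> A" for x
      using False A that \<open>a > 0\<close> base by (intro item[of x w a]) fastforce+
    then have "f A \<le> 3 * w + 2 * w + w"
      using A \<open>J \<subseteq> I\<close> \<open>a > 0\<close> \<open>w \<ge> 0\<close> by (intro split_bound[of A "2 * a" a] base two) auto
    then show ?thesis using \<open>w \<ge> 0\<close> by simp
  qed
  show ?thesis
  proof (cases "\<exists>x\<in>T. real (s x) > 4 * a")
    case True
    then obtain x where x: "x \<in> T" "real (s x) > 4 * a" by blast
    have "f {x} \<le> 2 * (7 * w)"
      using x T size[of x T "6 * a"] \<open>w \<ge> 0\<close> three by (intro item[of x "7 * w" "3 * a"]) auto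
    moreover have "f (T - {x}) \<le> 3 * w" using remove(2)[OF x(1) T(1)] x T by (intro two) auto
    ultimately show ?thesis using remove(1)[OF x(1) T(1)] \<open>w \<ge> 0\<close> by linarith
  next
    case False
    have "f {x} \<le> 2 * (3 * w)" if "x \<in> T" for x
      using False T that \<open>a > 0\<close> \<open>w \<ge> 0\<close> two by (intro item[of x "3 * w" "2 * a"]) fastforce+
    \<comment> \<open>Twenty is reached here; the case of an item above \<open>4 * a\<close> needs
      only \<open>14 * w + 3 * w\<close>.\<close>
    then have "f T \<le> 7 * w + 2 * (3 * w) + 7 * w"
      using T \<open>J \<subseteq> I\<close> \<open>a > 0\<close> \<open>w \<ge> 0\<close> by (intro split_bound[of T "3 * a" "3 * a"] three) auto
    then show ?thesis by simp
  qed
qed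

section \<open>Greedy filling when the single item is small\<close>

text \<open>Three copies of the final value pay for \<open>T\<close>. If no item exceeds
  \<open>C / 3\<close>, one copy is enough. A lone larger item costs two copies and the rest one.
  Two larger items cost one copy each, and so does the rest, of size below
  \<open>C / 3\<close>.\<close>

lemma greedy_phase_bound:
  assumes g: "greedy s f U R p" "U \<subseteq> I" "R \<subseteq> I" "U \<inter> R = {}"
    and fits: "\<And>j. j \<in> I \<Longrightarrow> real (s j) \<le> C \<Longrightarrow> j \<in> U \<union> R"
    and U: "real (sum s U) \<le> C / 3"
    and C: "C > 0"
    and single: "\<And>j. j \<in> I \<Longrightarrow> real (s j) \<le> C \<Longrightarrow> \<not> f {j} \<le> f U \<Longrightarrow>
      \<exists>M \<subseteq> I. real (sum s M) \<le> real (s j) / 2 \<and> f {j} \<le> 2 * f M"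
    and T: "T \<subseteq> I" "real (sum s T) \<le> C"
  shows "(1 - exp (- 1 / 3)) / 3 * f T \<le> f (run s C p U)"
proof -
  define x :: real where "x = exp (- 1 / 3)"
  define v where "v = f (run s C p U)"
  have x: "0 < x" "x < 1" by (simp_all add: x_def)
  \<comment> \<open>As \<open>1 - x ^ 3 = (1 - x) * (1 + x + x ^ 2)\<close> and
    \<open>2 / 3 + 4 / 9\<close> exceeds 1, the fraction \<open>1 - exp (- 1)\<close> is at least
    twice \<open>1 - x\<close>.\<close>
  have "1 - 1 / 3 \<le> x" using exp_ge_add_one_self[of "- 1 / 3"] by (simp add: x_def)
  then have "1 \<le> x + x\<^sup>2" using mult_mono[of "2/3" x "2/3" x] by (simp add: power2_eq_square)
  then have "0 \<le> (1 - x) * (x + x\<^sup>2 - 1)" using x by simp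
  moreover have x3: "x ^ 3 = exp (- 1)" by (simp add: x_def exp_of_nat_mult[symmetric])
  ultimately have e: "2 * (1 - x) \<le> 1 - exp (- 1)"
    by (simp add: x3[symmetric] algebra_simps power2_eq_square power3_eq_cube)
  have v: "f U \<le> v" "0 \<le> v"
    using f_le_run[OF g(1-3), of C] f_nonneg[OF g(2)] by (simp_all add: v_def)
  \<comment> \<open>The subtracted \<open>C / 3\<close> accounts for \<open>U\<close>;
    \<open>b \<le> C\<close> makes all items of \<open>A\<close> fit, so they lie in
    \<open>U \<union> R\<close>.\<close>
  have bound: "(1 - exp (- \<theta>)) * f A \<le> v"
    if "A \<subseteq> I" "real (sum s A) \<le> \<tau>" "\<And>t. t \<in> A \<Longrightarrow> real (s t) \<le> b" "\<theta> \<ge> 0" "0 < \<tau>" "b \<le> C"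
      "\<theta> * \<tau> \<le> C - b - C / 3" for A \<theta> \<tau> b
    unfolding v_def
  proof (rule greedy_bound[OF g])
    show "A \<subseteq> U \<union> R" using that fits by fastforce
  qed (use that U in auto)
  have third: "(1 - x) * f A \<le> v"
    if "A \<subseteq> I" "real (sum s A) \<le> C" "\<And>t. t \<in> A \<Longrightarrow> real (s t) \<le> C / 3" for A
    using bound[of A C "C / 3" "1 / 3"] that C by (simp add: x_def)
  have whole: "2 * (1 - x) * f A \<le> v" if "A \<subseteq> I" "real (sum s A) \<le> C / 3" for A
  proof -
    have "real (s t) \<le> C / 3" if "t \<in> A" for t
      using size_item_le[of t A] \<open>A \<subseteq> I\<close> \<open>real (sum s A) \<le> C / 3\<close> that by linarith
    then have "(1 - exp (- 1)) * f A \<le> v"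
      using bound[of A "C / 3" "C / 3" 1] that C by simp
    moreover have "2 * (1 - x) * f A \<le> (1 - exp (- 1)) * f A"
      using e f_nonneg[OF that(1)] by (rule mult_right_mono)
    ultimately show ?thesis by linarith
  qed
  have item: "(1 - x) * f {j} \<le> 2 * v" if j: "j \<in> I" "real (s j) \<le> C" for j
  proof (cases "f {j} \<le> f U")
    case True
    have "(1 - x) * f {j} \<le> 1 * f {j}" using x f_nonneg[of "{j}"] j by (intro mult_right_mono) auto
    then show ?thesis using True v by linarith
  next
    case False
    then obtain M where M: "M \<subseteq> I" "real (sum s M) \<le> real (s j) / 2" "f {j} \<le> 2 * f M"
      using single j by blast
    have "real (s t) \<le> C / 2" if "t \<in> M" for t
      using size_item_le[of t M] M j that by linarith
    \<comment> \<open>The room \<open>C - C / 2 - C / 3\<close> is a third of the size bound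
      \<open>C / 2\<close>.\<close>
    then have "(1 - x) * f M \<le> v"
      using bound[of M "C / 2" "C / 2" "1 / 3"] M j C by (simp add: x_def)
    moreover have "(1 - x) * f {j} \<le> (1 - x) * (2 * f M)" using M x by (intro mult_left_mono) auto
    ultimately show ?thesis by linarith
  qed
  have medium_item: "(1 - x) * f {j} \<le> v" if j: "j \<in> I" "real (s j) \<le> 2 * C / 3" for j
  proof (cases "f {j} \<le> f U")
    case True
    have "(1 - x) * f {j} \<le> 1 * f {j}" using x f_nonneg[of "{j}"] j by (intro mult_right_mono) auto
    then show ?thesis using True v by linarith
  next
    case False
    then obtain M where M: "M \<subseteq> I" "real (sum s M) \<le> real (s j) / 2" "f {j} \<le> 2 * f M"
      using single[of j] j C by auto
    \<comment> \<open>Here \<open>M\<close> has size at most \<open>C / 3\<close>, so the factor 2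
      in \<open>whole\<close> absorbs the one in \<open>f {j} \<le> 2 * f M\<close>.\<close>
    have "2 * (1 - x) * f M \<le> v" using whole M j by simp
    moreover have "(1 - x) * f {j} \<le> (1 - x) * (2 * f M)" using M x by (intro mult_left_mono) auto
    ultimately show ?thesis by linarith
  qed
  have "(1 - x) * f T \<le> 3 * v"
  proof (cases "\<exists>j\<in>T. real (s j) > C / 3")
    case False
    then show ?thesis using third[OF T] v by fastforce
  next
    case True
    then obtain j where j: "j \<in> T" "real (s j) > C / 3" by blast
    have Tj: "real (sum s T) = real (s j) + real (sum s (T - {j}))"
      using size_remove j T by blast
    have "(1 - x) * f T \<le> (1 - x) * (f {j} + f (T - {j}))"
      using f_remove_le[of j T] j T x by (intro mult_left_mono) auto
    then have fT: "(1 - x) * f T \<le> (1 - x) * f {j} + (1 - x) * f (T - {j})"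
      by (simp add: distrib_left)
    show ?thesis
    proof (cases "\<exists>k\<in>T - {j}. real (s k) > C / 3")
      case False
      then have "(1 - x) * f (T - {j}) \<le> v"
        using Tj T by (intro third) (auto simp: not_less)
      moreover have "(1 - x) * f {j} \<le> 2 * v" using size_item_le[of j T] T j by (intro item) auto
      ultimately show ?thesis using fT by linarith
    next
      case True
      then obtain k where k: "k \<in> T - {j}" "real (s k) > C / 3" by blast
      have Tk: "real (sum s (T - {j})) = real (s k) + real (sum s (T - {j} - {k}))"
        using size_remove[of k "T - {j}"] k T by blast
      have "(1 - x) * f (T - {j}) \<le> (1 - x) * (f {k} + f (T - {j} - {k}))"
        using f_remove_le[of k "T - {j}"] k T x by (intro mult_left_mono) auto
      then have "(1 - x) * f (T - {j}) \<le> (1 - x) * f {k} + (1 - x) * f (T - {j} - {k})"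
        by (simp add: distrib_left)
      moreover have "2 * (1 - x) * f (T - {j} - {k}) \<le> v" using T Tj Tk j k by (intro whole) auto
      then have "(1 - x) * f (T - {j} - {k}) \<le> v" using v by linarith
      \<comment> \<open>Each of the two items exceeds \<open>C / 3\<close>, leaving less than
        \<open>2 * C / 3\<close> for the other.\<close>
      moreover have "real (s k) \<le> 2 * C / 3" "real (s j) \<le> 2 * C / 3"
        using T(2) Tj Tk j(2) k(2) of_nat_0_le_iff[of "sum s (T - {j} - {k})"] by linarith+
      then have "(1 - x) * f {k} \<le> v" "(1 - x) * f {j} \<le> v"
        using T(1) j(1) k(1) by (auto intro!: medium_item)
      ultimately show ?thesis using fT by linarith
    qed
  qed
  then show ?thesis by (simp add: x_def v_def)
qed

end

section \<open>Numerical estimates for the exponential\<close>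

lemma root3_exp_1: "1 / root 3 (exp 1) = exp (- 1 / 3 :: real)"
proof -
  have "root 3 (exp 1) = exp (1 / 3 :: real)"
    by (rule real_root_pos_unique) (simp_all add: exp_of_nat_mult[symmetric])
  then show ?thesis by (simp add: exp_minus field_simps)
qed

text \<open>The value \<open>5 / 7\<close> is exactly what makes
  \<open>(1 - exp (- 1 / 3)) / 3\<close> at most \<open>2 / 21\<close>. The upper bound yields the
  decimal 0.094 and, cubed, 0.060.\<close>

lemma exp_minus_third_bounds: "5 / 7 \<le> exp (- 1 / 3 :: real)" "exp (- 1 / 3 :: real) < 0.7177"
proof -
  \<comment> \<open>Applied directly at \<open>- 1 / 3\<close>, the estimate
    \<open>1 + t \<le> exp t\<close> gives only \<open>2 / 3\<close>; at \<open>- 1 / 60\<close>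
    with a 20th power it is sharp enough.\<close>
  have "(59 / 60) ^ 20 \<le> exp (- 1 / 60 :: real) ^ 20"
    using exp_ge_add_one_self[of "- 1 / 60"] by (intro power_mono) auto
  also have "\<dots> = exp (- 1 / 3)" by (simp add: exp_of_nat_mult[symmetric])
  finally show "5 / 7 \<le> exp (- 1 / 3 :: real)" by (rule order_trans[rotated]) (simp add: power_divide)
  \<comment> \<open>\<open>85 / 72 = 1 + 1 / 6 + 1 / 72\<close> is the quadratic Taylor value at
    \<open>1 / 6\<close>.\<close>
  have "(85 / 72) ^ 2 \<le> exp (1 / 6 :: real) ^ 2"
    using exp_lower_Taylor_quadratic[of "1 / 6"]
    by (intro power_mono) (auto simp: power2_eq_square)
  also have "\<dots> = exp (1 / 3)" by (simp add: exp_of_nat_mult[symmetric])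
  finally have "1 / 0.7177 < exp (1 / 3 :: real)" by (simp add: power2_eq_square)
  then show "exp (- 1 / 3 :: real) < 0.7177" by (simp add: exp_minus field_simps)
qed

section \<open>Robustness from the two regimes of the single-item phase\<close>

theorem theorem3:
  fixes I :: "'a set" and s :: "'a \<Rightarrow> nat" and f :: "'a set \<Rightarrow> real"
    and \<gamma> :: real and L :: "'a \<Rightarrow> 'a set" and P :: "'a policy"
  assumes "finite I"
    and "\<And>i. i \<in> I \<Longrightarrow> s i > 0"
    and "\<And>X. X \<subseteq> I \<Longrightarrow> f X \<ge> 0"
    and "mono_on (Pow I) f"
    and "submodular_on I f"
    and "f {} = 0"
    and "0 < \<gamma>" "\<gamma> \<le> 1"
    and "\<And>i. i \<in> I \<Longrightarrow> approx_solution I s f \<gamma> (real (s i) / 2) (L i)"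
    and "policy_P I s f L P"
  shows "robust I s f (min (2 * \<gamma> / 21) ((1 - 1 / root 3 (exp 1)) / 3)) P
    \<and> (\<gamma> = 1 - 1 / exp 1 \<longrightarrow> robust I s f (2 * (1 - 1 / exp 1) / 21) P)
    \<and> 2 * (1 - 1 / exp 1) / 21 > (0.060 :: real)
    \<and> (\<gamma> = 1 \<longrightarrow> robust I s f ((1 - 1 / root 3 (exp 1)) / 3) P)
    \<and> (1 - 1 / root 3 (exp 1)) / 3 > (0.094 :: real)"
proof -
  interpret knapsack I s f
  proof
    show "f X \<le> f Y" if "X \<subseteq> Y" "Y \<subseteq> I" for X Y
      using assms(4) that by (auto simp: mono_on_def)
  qed (use assms(1,2,5,6) in \<open>auto simp: submodular_on_def\<close>)
  define x :: real where "x = exp (- 1 / 3)"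
  define m where "m = min (2 * \<gamma> / 21) ((1 - x) / 3)"
  define S where "S = single_items I f L"
  have P: "single_phase s f S I P" using assms(10) by (simp add: policy_P_def S_def)
  have x: "5 / 7 \<le> x" "x < 0.7177" using exp_minus_third_bounds by (simp_all add: x_def)
  have main: "m * f (OPT I s f C) \<le> f (outcome s P C)" if C: "C \<ge> 0" for C
  \<comment> \<open>\<open>greedy_phase_bound\<close> needs \<open>C > 0\<close>. At capacity zero,
    positive sizes leave only the empty set.\<close>
  proof (cases "C = 0")
    case True
    let ?O = "OPT I s f C"
    have O: "?O \<subseteq> I" "real (sum s ?O) \<le> 0"
      using is_arg_max_OPT[OF assms(1) C, of f s] True by (simp_all add: is_arg_max_def)
    then have "?O = {}" using size_item_le[of _ ?O] assms(2) by fastforce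
    moreover have "outcome s P C \<subseteq> I"
      unfolding outcome_def using run_subset[OF adaptive_single_phase[OF P]] by fastforce
    ultimately show ?thesis using f_empty f_nonneg by simp
  next
    case False
    then have C: "C > 0" using that by simp
    let ?O = "OPT I s f C"
    have O: "?O \<subseteq> I" "real (sum s ?O) \<le> C"
      using is_arg_max_OPT[OF assms(1), of C f s] C by (simp_all add: is_arg_max_def)
    have "S \<subseteq> I" by (auto simp: S_def single_items_def)
    have "\<forall>j\<in>I - I. C < real (s j)" by simp
    from single_phase_cases[OF P subset_refl \<open>S \<subseteq> I\<close> this f_empty]
    obtain q U R where run: "run s C P {} = run s C q U" and g: "greedy s f U R q" "R \<subseteq> I"
      and disj: "U \<inter> R = {}"
      and fits: "\<forall>j\<in>I. real (s j) \<le> C \<longrightarrow> j \<in> U \<union> R"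
      and max: "\<forall>j\<in>S. real (s j) \<le> C \<longrightarrow> f {j} \<le> f U"
      and U: "U = {} \<or> (\<exists>u\<in>S. U = {u} \<and> real (s u) \<le> C)"
      by metis
    have "U \<subseteq> I" using U \<open>S \<subseteq> I\<close> by blast
    have L: "L j \<subseteq> I" "real (sum s (L j)) \<le> real (s j) / 2"
      "\<gamma> * f (OPT I s f (real (s j) / 2)) \<le> f (L j)" if "j \<in> I" for j
      using assms(9)[OF that] by (simp_all add: approx_solution_def)
    have single: "\<exists>M \<subseteq> I. real (sum s M) \<le> real (s j) / 2 \<and> f {j} \<le> 2 * f M"
      if "j \<in> I" "real (s j) \<le> C" "\<not> f {j} \<le> f U" for j
    proof -
      \<comment> \<open>Fitting members of \<open>S\<close> are worth at most \<open>f U\<close>, so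
        \<open>j\<close> was rejected for \<open>S\<close> and \<open>L j\<close> serves as
        \<open>M\<close>.\<close>
      have "j \<notin> S" using max that by blast
      then have "f {j} \<le> 2 * f (L j)" using that(1) by (simp add: S_def single_items_def)
      then show ?thesis using L that(1) by blast
    qed
    have O_nonneg: "0 \<le> f ?O" using O(1) by (rule f_nonneg)
    have "m * f ?O \<le> f (run s C q U)"
    proof (cases "real (sum s U) \<le> C / 3")
      case True
      have "(1 - x) / 3 * f ?O \<le> f (run s C q U)"
        unfolding x_def using g \<open>U \<subseteq> I\<close> disj fits True C single O
        by (intro greedy_phase_bound) auto
      moreover have "m * f ?O \<le> (1 - x) / 3 * f ?O"
        using O_nonneg by (intro mult_right_mono) (simp_all only: m_def min.cobounded1 min.cobounded2)
      ultimately show ?thesis by linarith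
    next
      case False
      then obtain u where u: "u \<in> S" "U = {u}" using U C by auto
      then have "u \<in> I" "2 * f (L u) \<le> f {u}" by (auto simp: S_def single_items_def)
      \<comment> \<open>Any \<open>A\<close> of size at most \<open>s u / 2\<close> satisfies
        \<open>\<gamma> * f A \<le> f (L u) \<le> f {u} / 2\<close>, so \<open>w\<close> bounds its
        value.\<close>
      define w where "w = f {u} / (2 * \<gamma>)"
      have w: "f {u} = 2 * \<gamma> * w" using assms(7) by (simp add: w_def)
      have "0 \<le> f {u}" using f_nonneg \<open>u \<in> I\<close> by simp
      then have "w \<ge> 0" using assms(7) by (simp add: w_def)
      \<comment> \<open>Hence an item worth more than \<open>2 * w\<close> is worth more than
        \<open>f U\<close>, as \<open>single\<close> requires.\<close>
      then have "f {u} \<le> 2 * w" using w assms(8) mult_right_mono[of \<gamma> 1 w] by simp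
      have base: "f A \<le> w" if "A \<subseteq> I" "real (sum s A) \<le> real (s u) / 2" for A
      proof -
        have "f A \<le> f (OPT I s f (real (s u) / 2))"
          using is_arg_max_OPT[OF assms(1), of "real (s u) / 2" f s] that
          by (simp add: is_arg_max_linorder)
        then have "\<gamma> * f A \<le> \<gamma> * f (OPT I s f (real (s u) / 2))"
          using assms(7) by simp
        also have "\<dots> \<le> f (L u)" using L \<open>u \<in> I\<close> by blast
        finally have "\<gamma> * f A \<le> \<gamma> * w" using \<open>2 * f (L u) \<le> f {u}\<close> w by simp
        then show ?thesis using assms(7) by simp
      qed
      have C6: "C \<le> 6 * (real (s u) / 2)" using False u by simp
      \<comment> \<open>\<open>single\<close> covers fitting items only; the items of its witnesses
        fit too, so these sets stay within \<open>J\<close>.\<close>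
      define J where "J = {j \<in> I. real (s j) \<le> C}"
      have "f ?O \<le> 20 * w"
      proof (rule six_fold_size_bound[of J "real (s u) / 2" w])
        show "J \<subseteq> I" by (auto simp: J_def)
        show "real (s u) / 2 > 0" using assms(2)[OF \<open>u \<in> I\<close>] by simp
        show "f A \<le> w" if "A \<subseteq> J" "real (sum s A) \<le> real (s u) / 2" for A
          using that base \<open>J \<subseteq> I\<close> by blast
        show "\<exists>M \<subseteq> J. real (sum s M) \<le> real (s j) / 2 \<and> f {j} \<le> 2 * f M"
          if jJ: "j \<in> J" and jw: "\<not> f {j} \<le> 2 * w" for j
        proof -
          have j: "j \<in> I" "real (s j) \<le> C" using jJ by (auto simp: J_def)
          then obtain M where M: "M \<subseteq> I" "real (sum s M) \<le> real (s j) / 2" "f {j} \<le> 2 * f M"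
            using single[of j] jw u \<open>f {u} \<le> 2 * w\<close> by auto
          have "M \<subseteq> J" using size_item_le[of _ M] M j by (fastforce simp: J_def)
          then show ?thesis using M by blast
        qed
        show "?O \<subseteq> J" using size_item_le[of _ ?O] O by (fastforce simp: J_def)
        show "real (sum s ?O) \<le> 6 * (real (s u) / 2)" using O C6 by linarith
      qed (rule \<open>w \<ge> 0\<close>)
      \<comment> \<open>The factor 20 is relaxed to 21 to match the claimed constant.\<close>
      then have "2 * \<gamma> / 21 * f ?O \<le> 2 * \<gamma> / 21 * (21 * w)"
        using \<open>w \<ge> 0\<close> assms(7) by (intro mult_left_mono) auto
      then have "2 * \<gamma> / 21 * f ?O \<le> f U" using w u by simp
      moreover have "m * f ?O \<le> 2 * \<gamma> / 21 * f ?O"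
        using O_nonneg by (intro mult_right_mono) (simp_all only: m_def min.cobounded1 min.cobounded2)
      moreover have "f U \<le> f (run s C q U)" using g(1) \<open>U \<subseteq> I\<close> g(2) by (rule f_le_run)
      ultimately show ?thesis by linarith
    qed
    then show ?thesis by (simp add: outcome_def run)
  qed
  have robust: "robust I s f m P"
    using main adaptive_single_phase[OF P] by (simp add: robust_def)
  have x3: "x ^ 3 = 1 / exp 1" by (simp add: x_def exp_of_nat_mult[symmetric] exp_minus field_simps)
  have "x ^ 3 < 0.7177 ^ 3" using x by (intro power_strict_mono) auto
  then have e: "1 - 1 / exp 1 > (0.63 :: real)" unfolding x3[symmetric] by (simp add: power3_eq_cube)
  have "(5 / 7) ^ 3 \<le> x ^ 3" using x by (intro power_mono) auto
  then have e': "1 - 1 / exp 1 \<le> (0.64 :: real)" unfolding x3[symmetric] by (simp add: power3_eq_cube)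
  show ?thesis unfolding root3_exp_1 x_def[symmetric] m_def[symmetric]
  proof (intro conjI impI)
    show "robust I s f m P" by (rule robust)
    show "robust I s f (2 * (1 - 1 / exp 1) / 21) P" if "\<gamma> = 1 - 1 / exp 1"
    proof -
      \<comment> \<open>The first term is the minimum: by \<open>e'\<close> it is below 0.061, while
        \<open>(1 - x) / 3\<close> exceeds 0.094.\<close>
      have "m = 2 * (1 - 1 / exp 1) / 21" using that x e' by (simp add: m_def)
      with robust show ?thesis by simp
    qed
    show "robust I s f ((1 - x) / 3) P" if "\<gamma> = 1"
    proof -
      have "m = (1 - x) / 3" using that x by (simp add: m_def)
      with robust show ?thesis by simp
    qed
    show "2 * (1 - 1 / exp 1) / 21 > (0.060 :: real)" using e by simp
    show "(1 - x) / 3 > 0.094" using x by simp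
  qed
qed

end
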